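(* Let $\Sigma = \{a_1, \ldots, a_k\}$ be a finite alphabet and let $L \subseteq \Sigma^*$ be a commutative group language with minimal permutation automaton $\mathcal A = (\Sigma, Q, \delta, q_0, F)$ such that $L = L(\mathcal A)$. Then the iterated shuffle $L^{ш,*}$ is regular and recognizable by an automaton with at most $$\Big( |Q|^k \prod_{i=1}^k p_i \Big) + 1$$ states, where, for $i \in \{1,\ldots,k\}$, $p_i > 0$ is minimal such that $\delta(q_0, a_i^{p_i}) = q_0$.
   Context: All automata are finite, complete and deterministic. A permutation automaton is an automaton $(\Sigma,Q,\delta,q_0,F)$ such that for each letter $a \in \Sigma$ the map $q \mapsto \delta(q,a)$ is a bijection of $Q$. A group language is a language recognized by some permutation automaton. "Minimal" refers to having the smallest number of states among automata recognizing $L$. A language $L \subseteq \Sigma^*$ is commutative if $\operatorname{perm}(L) = L$, where $\operatorname{perm}(L) = \{u \in \Sigma^* \mid \exists w \in L: |u|_a = |w|_a \text{ for all } a \in \Sigma\}$ and $|w|_a$ is the number of occurrences of $a$ in $w$. The shuffle of words $u,v$, written $u\,ш\,v$, is the set of all words $x_1y_1x_2y_2\cdots x_ny_n$ with $x_i,y_i \in \Sigma^*$, $u = x_1\cdots x_n$, $v = y_1 \cdots y_n$; for languages, $L_1\,ш\,L_2 = \bigcup_{x \in L_1, y \in L_2} x\,ш\,y$. The iterated shuffle of $L$ is $L^{ш,*} = \bigcup_{n \ge 0} (L\,ш\cdots ш\,L)$ ($n$ copies, the case $n=0$ giving $\{\varepsilon\}$). *)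

theory Defs
  imports Main
begin

section \<open>Automata\<close>

record ('a, 'q) dfa =
  alphabet :: "'a set"
  states :: "'q set"
  trans :: "'q \<Rightarrow> 'a \<Rightarrow> 'q"
  init :: 'q
  final :: "'q set"

locale automaton =
  fixes A :: "('a, 'q) dfa"
  assumes finite_alphabet: "finite (alphabet A)"
    and finite_states: "finite (states A)"
    and init_in_states: "init A \<in> states A"
    and final_subset: "final A \<subseteq> states A"
    and trans_closed: "\<And>q a. q \<in> states A \<Longrightarrow> a \<in> alphabet A \<Longrightarrow> trans A q a \<in> states A"

locale permutation_automaton = automaton A for A :: "('a, 'q) dfa" +
  assumes trans_bij: "\<And>a. a \<in> alphabet A \<Longrightarrow> bij_betw (\<lambda>q. trans A q a) (states A) (states A)"

definition run :: "('a, 'q) dfa \<Rightarrow> 'q \<Rightarrow> 'a list \<Rightarrow> 'q" where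
  "run A q w = foldl (trans A) q w"

definition lang :: "('a, 'q) dfa \<Rightarrow> 'a list set" where
  "lang A = {w \<in> lists (alphabet A). run A (init A) w \<in> final A}"

text \<open>
  HOL cannot quantify over the type of states inside a formula. Below, quantification over
  automata therefore ranges over automata with natural numbers as states; lemma
  \<open>ex_nat_automaton\<close> shows that nothing is lost, since every automaton is isomorphic to one
  of these.
\<close>

definition regular :: "'a set \<Rightarrow> 'a list set \<Rightarrow> bool" where
  "regular \<Sigma> L \<longleftrightarrow> (\<exists>B :: ('a, nat) dfa. automaton B \<and> alphabet B = \<Sigma> \<and> lang B = L)"

definition group_language :: "'a set \<Rightarrow> 'a list set \<Rightarrow> bool" where
  "group_language \<Sigma> L \<longleftrightarrow>
     (\<exists>B :: ('a, nat) dfa. permutation_automaton B \<and> alphabet B = \<Sigma> \<and> lang B = L)"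

definition minimal_automaton :: "('a, 'q) dfa \<Rightarrow> bool" where
  "minimal_automaton A \<longleftrightarrow> automaton A \<and>
     (\<forall>B :: ('a, nat) dfa. automaton B \<and> alphabet B = alphabet A \<and> lang B = lang A
        \<longrightarrow> card (states A) \<le> card (states B))"

text \<open>
  In a permutation automaton some positive power of each letter fixes the initial state, so the
  minimum exists.
\<close>

definition letter_period :: "('a, 'q) dfa \<Rightarrow> 'a \<Rightarrow> nat" where
  "letter_period A a = (LEAST p. p > 0 \<and> run A (init A) (replicate p a) = init A)"


section \<open>Commutative languages and shuffle\<close>

definition perm :: "'a set \<Rightarrow> 'a list set \<Rightarrow> 'a list set" where
  "perm \<Sigma> L = {u \<in> lists \<Sigma>. \<exists>w\<in>L. \<forall>a\<in>\<Sigma>. count_list u a = count_list w a}"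

definition commutative_language :: "'a set \<Rightarrow> 'a list set \<Rightarrow> bool" where
  "commutative_language \<Sigma> L \<longleftrightarrow> L \<subseteq> lists \<Sigma> \<and> perm \<Sigma> L = L"

definition lang_shuffle :: "'a list set \<Rightarrow> 'a list set \<Rightarrow> 'a list set" where
  "lang_shuffle K L = (\<Union>x\<in>K. \<Union>y\<in>L. shuffles x y)"

primrec shuffle_power :: "'a list set \<Rightarrow> nat \<Rightarrow> 'a list set" where
  "shuffle_power L 0 = {[]}"
| "shuffle_power L (Suc n) = lang_shuffle L (shuffle_power L n)"

definition iterated_shuffle :: "'a list set \<Rightarrow> 'a list set" where
  "iterated_shuffle L = (\<Union>n. shuffle_power L n)"


section \<open>Adequacy of the encodings\<close>

lemma run_closed:
  assumes "automaton A" "q \<in> states A" "w \<in> lists (alphabet A)"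
  shows "run A q w \<in> states A"
  using assms(2,3)
proof (induction w arbitrary: q)
  case Nil
  then show ?case by (simp add: run_def)
next
  case (Cons a w)
  have "trans A q a \<in> states A"
    using Cons.prems automaton.trans_closed[OF assms(1)] by simp
  then show ?case using Cons by (simp add: run_def)
qed

lemma ex_nat_automaton:
  fixes A :: "('a, 'q) dfa"
  assumes A: "automaton A"
  shows "\<exists>B :: ('a, nat) dfa. automaton B \<and> alphabet B = alphabet A \<and> lang B = lang A
    \<and> card (states B) = card (states A) \<and> (permutation_automaton A \<longrightarrow> permutation_automaton B)"
proof -
  interpret automaton A by fact
  obtain f :: "'q \<Rightarrow> nat" where inj: "inj_on f (states A)"
    using finite_states finite_imp_inj_to_nat_seg by metis
  define g where "g = inv_into (states A) f"
  have gf: "g (f q) = q" if "q \<in> states A" for q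
    using inj that by (simp add: g_def)
  define B :: "('a, nat) dfa" where
    "B = \<lparr>alphabet = alphabet A, states = f ` states A,
          trans = (\<lambda>n a. f (trans A (g n) a)), init = f (init A), final = f ` final A\<rparr>"
  have aut: "automaton B"
    using finite_alphabet finite_states init_in_states final_subset trans_closed
    by unfold_locales (auto simp: B_def gf)
  have run: "run B (f q) w = f (run A q w)"
    if "q \<in> states A" "w \<in> lists (alphabet A)" for q w
    using that
  proof (induction w arbitrary: q)
    case Nil
    then show ?case by (simp add: run_def)
  next
    case (Cons a w)
    have "trans A q a \<in> states A" using Cons.prems trans_closed by simp
    moreover have "trans B (f q) a = f (trans A q a)"
      using Cons.prems by (simp add: B_def gf)
    ultimately show ?case using Cons by (simp add: run_def)
  qed
  have fin: "f q \<in> f ` final A \<longleftrightarrow> q \<in> final A" if "q \<in> states A" for q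
    using inj_on_image_mem_iff[OF inj that final_subset] .
  have "run B (init B) w \<in> final B \<longleftrightarrow> run A (init A) w \<in> final A"
    if "w \<in> lists (alphabet A)" for w
  proof -
    have "run B (init B) w = f (run A (init A) w)"
      using run[OF init_in_states that] by (simp add: B_def)
    then show ?thesis
      using fin[OF run_closed[OF A init_in_states that]] by (simp add: B_def)
  qed
  moreover have alph: "alphabet B = alphabet A" by (simp add: B_def)
  ultimately have lang: "lang B = lang A" by (auto simp: lang_def)
  have card: "card (states B) = card (states A)"
    using inj by (simp add: B_def card_image)
  have "permutation_automaton B" if P: "permutation_automaton A"
  proof -
    have "bij_betw (\<lambda>n. trans B n a) (states B) (states B)" if "a \<in> alphabet B" for a
    proof -
      have bA: "bij_betw (\<lambda>q. trans A q a) (states A) (states A)"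
        using permutation_automaton.trans_bij[OF P] that alph by simp
      have bf: "bij_betw f (states A) (states B)"
        using inj by (simp add: B_def bij_betw_def)
      have bg: "bij_betw g (states B) (states A)"
        unfolding g_def by (rule bij_betw_inv_into[OF bf])
      have "(\<lambda>n. trans B n a) = f \<circ> (\<lambda>q. trans A q a) \<circ> g"
        by (simp add: B_def fun_eq_iff)
      then show ?thesis
        using bij_betw_trans[OF bg bij_betw_trans[OF bA bf]] by (simp add: comp_assoc)
    qed
    then show ?thesis
      using aut by (simp add: permutation_automaton_def permutation_automaton_axioms_def)
  qed
  then show ?thesis using aut alph lang card by blast
qed

lemma minimal_automaton_le:
  fixes A :: "('a, 'q) dfa" and B :: "('a, 'r) dfa"
  assumes "minimal_automaton A" "automaton B" "alphabet B = alphabet A" "lang B = lang A"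
  shows "card (states A) \<le> card (states B)"
  using assms ex_nat_automaton[OF assms(2)] unfolding minimal_automaton_def by metis

text \<open>
  The library's \<open>shuffles\<close> is the set of all \<open>x\<^sub>1 y\<^sub>1 \<dots> x\<^sub>n y\<^sub>n\<close> with
  \<open>u = x\<^sub>1 \<dots> x\<^sub>n\<close> and \<open>v = y\<^sub>1 \<dots> y\<^sub>n\<close>.
\<close>

lemma append_shuffles_left: "z \<in> shuffles u v \<Longrightarrow> x @ z \<in> shuffles (x @ u) v"
  by (induction x) (auto intro: Cons_in_shuffles_leftI)

lemma append_shuffles_right: "z \<in> shuffles u v \<Longrightarrow> y @ z \<in> shuffles u (y @ v)"
  by (induction y) (auto intro: Cons_in_shuffles_rightI)

lemma shuffles_eq_factorizations:
  "shuffles u v = {concat (map (\<lambda>(x, y). x @ y) ps) | ps.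
     u = concat (map fst ps) \<and> v = concat (map snd ps)}" (is "_ = ?R u v")
proof (intro set_eqI iffI)
  fix z assume "z \<in> shuffles u v"
  then show "z \<in> ?R u v"
  proof (induction z arbitrary: u v)
    case Nil
    then show ?case by (auto intro: exI[of _ "[]"])
  next
    case (Cons c z)
    then consider u' where "u = c # u'" "z \<in> shuffles u' v"
      | v' where "v = c # v'" "z \<in> shuffles u v'"
      by (cases u; cases v) (auto simp: Cons_in_shuffles_iff)
    then show ?case
    proof cases
      case 1
      then obtain ps where "z = concat (map (\<lambda>(x, y). x @ y) ps)"
          "u' = concat (map fst ps)" "v = concat (map snd ps)"
        using Cons.IH by blast
      then show ?thesis using 1 by (auto intro!: exI[of _ "([c], []) # ps"])
    next
      case 2
      then obtain ps where "z = concat (map (\<lambda>(x, y). x @ y) ps)"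
          "u = concat (map fst ps)" "v' = concat (map snd ps)"
        using Cons.IH by blast
      then show ?thesis using 2 by (auto intro!: exI[of _ "([], [c]) # ps"])
    qed
  qed
next
  fix z assume "z \<in> ?R u v"
  then obtain ps where "z = concat (map (\<lambda>(x, y). x @ y) ps)"
      "u = concat (map fst ps)" "v = concat (map snd ps)" by blast
  then show "z \<in> shuffles u v"
  proof (induction ps arbitrary: z u v)
    case Nil
    then show ?case by simp
  next
    case (Cons p ps)
    obtain x y where p: "p = (x, y)" by (cases p)
    have "y @ concat (map (\<lambda>(x, y). x @ y) ps)
        \<in> shuffles (concat (map fst ps)) (y @ concat (map snd ps))"
      by (rule append_shuffles_right, rule Cons.IH) simp_all
    then show ?case using append_shuffles_left Cons.prems p by fastforce
  qed
qed

end

theory Submission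
  imports Defs "HOL-Library.Multiset" "HOL-Library.FuncSet"
begin

text \<open>
  A commutative language is a set of multisets of letters, and its iterated shuffle is the
  submonoid generated by that set. Let \<open>n\<close> be the number of states of the permutation automaton.
  If a multiset is a sum of more than \<open>n\<close> members of \<open>L\<close>, then by the pigeonhole principle some
  block of the summands acts trivially on a state; the group property allows one to merge this
  block into another summand. So at most \<open>n\<close> summands suffice. If moreover a letter \<open>a\<close> of period
  \<open>p\<close> occurs at least \<open>n p\<close> times, then one summand contains it at least \<open>p\<close> times, and
  \<open>p\<close> occurrences can be deleted there. Hence it is enough to count each letter \<open>a\<close> up to \<open>n p\<close>,
  falling back to \<open>(n - 1) p\<close> at that point; the additional state is needed for the empty word.
\<close>

section \<open>Iterated shuffles and multisets\<close>

lemma mset_shuffles: "z \<in> shuffles x y \<Longrightarrow> mset z = mset x + mset y"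
proof (induction x y arbitrary: z rule: shuffles.induct)
  case (3 x xs y ys)
  then show ?case by auto
qed auto

text \<open>Converse of \<open>mset_shuffles\<close>: the letters of \<open>z\<close> are dealt out
  one by one, each to a part that still contains it. The order within \<open>x\<close> and
  \<open>y\<close> is dictated by \<open>z\<close>, so only their multisets can be
  prescribed.\<close>

lemma ex_shuffles_mset:
  "mset z = M + N \<Longrightarrow> \<exists>x y. mset x = M \<and> mset y = N \<and> z \<in> shuffles x y"
proof (induction z arbitrary: M N)
  case Nil
  then show ?case by auto
next
  case (Cons c z)
  have "c \<in># M + N" using Cons.prems by (metis list.set_intros(1) set_mset_mset)
  then consider M' where "M = add_mset c M'" | N' where "N = add_mset c N'"
    by (meson mset_add union_iff)
  then show ?case
  proof cases
    case 1
    then have "mset z = M' + N" using Cons.prems by simp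
    with Cons.IH obtain x y where "mset x = M'" "mset y = N" "z \<in> shuffles x y" by blast
    then show ?thesis
      using 1 by (intro exI[of _ "c # x"] exI[of _ y]) (auto intro: Cons_in_shuffles_leftI)
  next
    case 2
    then have "mset z = M + N'" using Cons.prems by simp
    with Cons.IH obtain x y where "mset x = M" "mset y = N'" "z \<in> shuffles x y" by blast
    then show ?thesis
      using 2 by (intro exI[of _ x] exI[of _ "c # y"]) (auto intro: Cons_in_shuffles_rightI)
  qed
qed

lemma commutative_language_mset:
  assumes "commutative_language \<Sigma> L" "mset u = mset w"
  shows "u \<in> L \<longleftrightarrow> w \<in> L"
proof -
  have "v \<in> L" if "mset v = mset x" "x \<in> L" for v x
  proof -
    have "x \<in> lists \<Sigma>" using assms(1) that(2) by (auto simp: commutative_language_def)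
    then have "v \<in> lists \<Sigma>" using that(1) by (metis in_lists_conv_set mset_eq_setD)
    moreover have "count_list v a = count_list x a" for a
      using that(1) by (metis count_mset)
    ultimately have "v \<in> perm \<Sigma> L" using that(2) by (auto simp: perm_def)
    then show ?thesis using assms(1) by (simp add: commutative_language_def)
  qed
  then show ?thesis using assms(2) by metis
qed

text \<open>Concatenation can replace shuffling because only letter counts matter: the pieces
  extracted from \<open>z\<close> are rearrangements of the given words, so commutativity keeps them
  in \<open>L\<close> and in the smaller power.\<close>

lemma shuffle_power_iff:
  assumes L: "commutative_language \<Sigma> L"
  shows "z \<in> shuffle_power L n \<longleftrightarrow>
    (\<exists>ws. length ws = n \<and> set ws \<subseteq> L \<and> mset z = mset (concat ws))"
proof (induction n arbitrary: z)
  case 0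
  then show ?case by simp
next
  case (Suc n)
  show ?case
  proof
    assume "z \<in> shuffle_power L (Suc n)"
    then obtain x y where xy: "x \<in> L" "y \<in> shuffle_power L n" "z \<in> shuffles x y"
      by (auto simp: lang_shuffle_def)
    then obtain ws where "length ws = n" "set ws \<subseteq> L" "mset y = mset (concat ws)"
      using Suc by blast
    then show "\<exists>ws. length ws = Suc n \<and> set ws \<subseteq> L \<and> mset z = mset (concat ws)"
      using xy mset_shuffles[OF xy(3)] by (intro exI[of _ "x # ws"]) auto
  next
    assume "\<exists>ws. length ws = Suc n \<and> set ws \<subseteq> L \<and> mset z = mset (concat ws)"
    then obtain w ws where ws: "length ws = n" "w \<in> L" "set ws \<subseteq> L"
        "mset z = mset w + mset (concat ws)"
      by (auto simp: length_Suc_conv)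
    then obtain x y where xy: "mset x = mset w" "mset y = mset (concat ws)" "z \<in> shuffles x y"
      using ex_shuffles_mset by blast
    have "x \<in> L" using commutative_language_mset[OF L xy(1)] ws by simp
    moreover have "y \<in> shuffle_power L n" using Suc xy ws by blast
    ultimately show "z \<in> shuffle_power L (Suc n)" using xy by (auto simp: lang_shuffle_def)
  qed
qed

text \<open>The empty sum is excluded because it has no summand that could absorb a period: with it,
  \<open>shuffle_sums_period\<close> would fail for \<open>L = {}\<close> and a one-state
  automaton.\<close>

definition shuffle_sums :: "'a list set \<Rightarrow> 'a multiset set" where
  "shuffle_sums L = {mset (concat ws) | ws. ws \<noteq> [] \<and> set ws \<subseteq> L}"

lemma iterated_shuffle_iff:
  assumes "commutative_language \<Sigma> L"
  shows "z \<in> iterated_shuffle L \<longleftrightarrow> z = [] \<or> mset z \<in> shuffle_sums L"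
proof -
  have "z \<in> iterated_shuffle L \<longleftrightarrow> (\<exists>ws. set ws \<subseteq> L \<and> mset z = mset (concat ws))"
    by (auto simp: iterated_shuffle_def shuffle_power_iff[OF assms])
  also have "\<dots> \<longleftrightarrow> z = [] \<or> mset z \<in> shuffle_sums L"
  proof
    assume "\<exists>ws. set ws \<subseteq> L \<and> mset z = mset (concat ws)"
    then obtain ws where ws: "set ws \<subseteq> L" "mset z = mset (concat ws)" by blast
    then show "z = [] \<or> mset z \<in> shuffle_sums L"
      by (cases "ws = []") (auto simp: shuffle_sums_def)
  next
    assume "z = [] \<or> mset z \<in> shuffle_sums L"
    then show "\<exists>ws. set ws \<subseteq> L \<and> mset z = mset (concat ws)"
      by (auto simp: shuffle_sums_def intro: exI[of _ "[]"])
  qed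
  finally show ?thesis .
qed

lemma iterated_shuffle_subset_lists:
  assumes "commutative_language \<Sigma> L"
  shows "iterated_shuffle L \<subseteq> lists \<Sigma>"
proof
  fix z assume "z \<in> iterated_shuffle L"
  then obtain ws where "set ws \<subseteq> L" "mset z = mset (concat ws)"
    by (auto simp: iterated_shuffle_def shuffle_power_iff[OF assms])
  then have "set z = set (concat ws)" "set ws \<subseteq> lists \<Sigma>"
    using assms mset_eq_setD[of z "concat ws"] by (auto simp only: commutative_language_def)
  then show "z \<in> lists \<Sigma>" by auto
qed


section \<open>Commutative permutation automata\<close>

lemma run_append: "run A q (u @ v) = run A (run A q u) v"
  by (simp add: run_def)

text \<open>The orbit of \<open>x\<close> stays in a finite set, so two iterates agree; injectivity
  on \<open>S\<close> cancels the smaller power.\<close>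

lemma ex_funpow_fixed:
  assumes "finite S" "bij_betw f S S" "x \<in> S"
  shows "\<exists>n>0. (f ^^ n) x = x"
proof -
  have bij: "bij_betw (f ^^ n) S S" for n
  proof (induction n)
    case 0
    then show ?case by (simp add: bij_betw_def)
  next
    case (Suc n)
    show ?case using bij_betw_trans[OF Suc assms(2)] by (simp only: funpow.simps(2))
  qed
  then have mem: "(f ^^ n) x \<in> S" for n
    using assms(3) by (meson bij_betwE)
  then have "finite (range (\<lambda>n. (f ^^ n) x))"
    using assms(1) by (meson finite_subset image_subsetI)
  then have "\<not> inj (\<lambda>n. (f ^^ n) x)"
    using finite_imageD by blast
  then obtain i j where ij: "(f ^^ i) x = (f ^^ j) x" "i < j"
    unfolding inj_def by (metis nat_neq_iff)
  then have "(f ^^ i) x = (f ^^ i) ((f ^^ (j - i)) x)"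
    by (metis add_diff_inverse_nat comp_apply funpow_add less_imp_le_nat not_less)
  then have "(f ^^ (j - i)) x = x"
    using bij_betw_imp_inj_on[OF bij[of i]] mem assms(3) by (metis inj_onD)
  then show ?thesis using ij(2) by (metis zero_less_diff)
qed

lemma run_concat_replicate:
  "run A q (concat (replicate n u)) = ((\<lambda>q. run A q u) ^^ n) q"
proof (induction n arbitrary: q)
  case 0
  then show ?case by (simp add: run_def)
next
  case (Suc n)
  then show ?case by (simp add: run_append funpow_swap1[of "\<lambda>q. run A q u"])
qed

context permutation_automaton
begin

lemma run_bij:
  "w \<in> lists (alphabet A) \<Longrightarrow> bij_betw (\<lambda>q. run A q w) (states A) (states A)"
proof (induction w)
  case Nil
  then show ?case by (simp add: run_def bij_betw_def inj_on_def)
next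
  case (Cons a w)
  then have "bij_betw ((\<lambda>q. run A q w) \<circ> (\<lambda>q. trans A q a)) (states A) (states A)"
    by (intro bij_betw_trans[OF trans_bij]) auto
  then show ?case by (simp add: run_def comp_def)
qed

lemma ex_run_power_fixed:
  assumes "w \<in> lists (alphabet A)"
  shows "\<exists>n>0. run A (init A) (concat (replicate n w)) = init A"
  unfolding run_concat_replicate
  by (rule ex_funpow_fixed[OF finite_states run_bij[OF assms] init_in_states])

lemma letter_period:
  assumes "a \<in> alphabet A"
  shows "letter_period A a > 0"
    and "run A (init A) (replicate (letter_period A a) a) = init A"
proof -
  have "concat (replicate n [a]) = replicate n a" for n by (induction n) auto
  then have "\<exists>p>0. run A (init A) (replicate p a) = init A"
    using ex_run_power_fixed[of "[a]"] assms by simp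
  from LeastI_ex[OF this] show "letter_period A a > 0"
      "run A (init A) (replicate (letter_period A a) a) = init A"
    by (simp_all add: letter_period_def)
qed

end

locale commutative_permutation_automaton = permutation_automaton A for A :: "('a, 'q) dfa" +
  assumes commutative: "commutative_language (alphabet A) (lang A)"
begin

abbreviation n_states :: nat where "n_states \<equiv> card (states A)"

lemma lang_mset: "mset u = mset w \<Longrightarrow> u \<in> lang A \<longleftrightarrow> w \<in> lang A"
  by (rule commutative_language_mset[OF commutative])

lemma n_states_pos: "n_states > 0"
  using finite_states init_in_states by (auto simp: card_gt_0_iff)

lemma lang_append_run:
  assumes "u \<in> lists (alphabet A)" "v \<in> lists (alphabet A)"
    and "run A (init A) u = run A (init A) v"
  shows "u @ w \<in> lang A \<longleftrightarrow> v @ w \<in> lang A"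
  using assms by (auto simp: lang_def run_append)

lemma lang_append_period:
  assumes "a \<in> alphabet A"
  shows "replicate (letter_period A a) a @ w \<in> lang A \<longleftrightarrow> w \<in> lang A"
proof -
  have "replicate (letter_period A a) a \<in> lists (alphabet A)" using assms by auto
  moreover have "run A (init A) (replicate (letter_period A a) a) = run A (init A) []"
    using letter_period(2)[OF assms] by (simp add: run_def)
  ultimately show ?thesis using lang_append_run[of _ "[]" w] by simp
qed

text \<open>
  Cancelling \<open>u\<close> on the left is not possible directly, as \<open>u @ w\<close> need not be in the language;
  instead \<open>u\<close> is completed to a power \<open>u\<^sup>m\<close> that fixes the initial state.
\<close>

lemma lang_append_trivial:
  assumes u: "u \<in> lists (alphabet A)" and x: "x \<in> lists (alphabet A)"
    and eq: "run A (init A) (u @ x) = run A (init A) u"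
  shows "x @ w \<in> lang A \<longleftrightarrow> w \<in> lang A"
proof -
  obtain m where m: "run A (init A) (concat (replicate (Suc m) u)) = init A"
    using ex_run_power_fixed[OF u] by (metis gr0_implies_Suc)
  let ?U = "concat (replicate m u)"
  have U: "concat (replicate (Suc m) u) \<in> lists (alphabet A)" using u by auto
  have cancel: "u @ ?U @ v \<in> lang A \<longleftrightarrow> v \<in> lang A" for v
    using lang_append_run[OF U, of "[]" v] m by (simp add: run_def)
  have "x @ w \<in> lang A \<longleftrightarrow> u @ ?U @ x @ w \<in> lang A" by (simp only: cancel)
  also have "\<dots> \<longleftrightarrow> (u @ x) @ ?U @ w \<in> lang A" by (rule lang_mset) simp
  also have "\<dots> \<longleftrightarrow> u @ ?U @ w \<in> lang A"
    using u x by (intro lang_append_run eq) auto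
  also have "\<dots> \<longleftrightarrow> w \<in> lang A" by (rule cancel)
  finally show ?thesis .
qed

text \<open>Of the \<open>n_states + 1\<close> prefixes with at most \<open>n_states\<close> words,
  two lead to the same state. The block \<open>xs\<close> between them can be prepended to the next
  word by \<open>lang_append_trivial\<close>, which leaves the concatenation unchanged.\<close>

lemma ex_shorter_sum:
  assumes ws: "set ws \<subseteq> lang A" and len: "n_states < length ws"
  shows "\<exists>ws'. ws' \<noteq> [] \<and> set ws' \<subseteq> lang A \<and> concat ws' = concat ws \<and> length ws' < length ws"
proof -
  have concat_in: "concat vs \<in> lists (alphabet A)" if "set vs \<subseteq> set ws" for vs
    using that ws by (fastforce simp: lang_def)
  let ?f = "\<lambda>j. run A (init A) (concat (take j ws))"
  have "?f ` {..n_states} \<subseteq> states A"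
    using concat_in run_closed[OF automaton_axioms init_in_states] by (auto simp: set_take_subset)
  then have "\<not> inj_on ?f {..n_states}"
    using card_inj_on_le[of ?f "{..n_states}" "states A"] finite_states by auto
  then obtain i j where ij: "i < j" "j \<le> n_states" "?f i = ?f j"
    unfolding inj_on_def by (metis atMost_iff nat_neq_iff)
  define us xs where "us = take i ws" and "xs = drop i (take j ws)"
  have us_xs: "us @ xs = take j ws"
    using append_take_drop_id[of i "take j ws"] ij(1) by (simp add: us_def xs_def min_def)
  have xs: "xs \<noteq> []" using ij len by (simp add: xs_def)
  \<comment> \<open>A word to absorb the block remains, since
    \<open>j \<le> n_states < length ws\<close>.\<close>
  obtain y ys where y: "drop j ws = y # ys"
    using ij len by (cases "drop j ws") auto
  have split: "ws = us @ xs @ y # ys"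
    using us_xs y by (metis append.assoc append_take_drop_id)
  have "run A (init A) (concat us @ concat xs) = run A (init A) (concat us)"
    using ij(3) us_xs by (metis concat_append us_def)
  moreover have "concat us \<in> lists (alphabet A)" "concat xs \<in> lists (alphabet A)"
    by (rule concat_in, force simp: split)+
  ultimately have "concat xs @ y \<in> lang A"
    using lang_append_trivial ws split by auto
  then show ?thesis
    using xs ws by (intro exI[of _ "us @ (concat xs @ y) # ys"]) (auto simp: split)
qed

lemma shuffle_sums_bounded:
  assumes "M \<in> shuffle_sums (lang A)"
  obtains ws where "M = mset (concat ws)" "ws \<noteq> []" "set ws \<subseteq> lang A" "length ws \<le> n_states"
proof -
  let ?P = "\<lambda>ws. M = mset (concat ws) \<and> ws \<noteq> [] \<and> set ws \<subseteq> lang A"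
  have "\<exists>ws. ?P ws" using assms by (auto simp: shuffle_sums_def)
  then obtain ws where ws: "?P ws" and least: "\<And>vs. ?P vs \<Longrightarrow> length ws \<le> length vs"
    using ex_has_least_nat[of ?P _ length] by metis
  have "length ws \<le> n_states"
    using ex_shorter_sum[of ws] least ws by (metis not_less)
  then show thesis using that ws by blast
qed

text \<open>Adding a period only needs one summand to receive it. For deletion, the threshold
  ensures that \<open>a\<close> occurs at least \<open>n_states\<close> periods' worth of times once
  the period is added; spread over at most \<open>n_states\<close> summands, this leaves one with a
  full period.\<close>

lemma shuffle_sums_period:
  assumes a: "a \<in> alphabet A" and large: "(n_states - 1) * letter_period A a \<le> count M a"
  shows "M + replicate_mset (letter_period A a) a \<in> shuffle_sums (lang A) \<longleftrightarrow>
    M \<in> shuffle_sums (lang A)"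
proof
  let ?p = "letter_period A a"
  assume "M \<in> shuffle_sums (lang A)"
  then obtain w ws where "M = mset (concat (w # ws))" "set (w # ws) \<subseteq> lang A"
    unfolding shuffle_sums_def by (auto simp: neq_Nil_conv)
  then show "M + replicate_mset ?p a \<in> shuffle_sums (lang A)"
    using lang_append_period[OF a, of w] unfolding shuffle_sums_def
    by (intro CollectI exI[of _ "(replicate ?p a @ w) # ws"]) auto
next
  let ?p = "letter_period A a"
  assume "M + replicate_mset ?p a \<in> shuffle_sums (lang A)"
  then obtain ws where ws: "M + replicate_mset ?p a = mset (concat ws)" "ws \<noteq> []"
      "set ws \<subseteq> lang A" "length ws \<le> n_states"
    by (rule shuffle_sums_bounded)
  have "\<exists>w\<in>set ws. ?p \<le> count (mset w) a"
  proof (rule ccontr)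
    assume small: "\<not> ?thesis"
    \<comment> \<open>The strict bound fails for the empty list, hence the induction over non-empty
      lists.\<close>
    have "count (mset (concat vs)) a < length vs * ?p"
      if "vs \<noteq> []" "set vs \<subseteq> set ws" for vs
      using that
    proof (induction vs rule: list_nonempty_induct)
      case (single v)
      then show ?case using small by auto
    next
      case (cons v vs)
      then have "count (mset v) a < ?p" using small by auto
      with cons show ?case by auto
    qed
    from this[of ws] have "count (mset (concat ws)) a < length ws * ?p" using ws(2) by simp
    also have "\<dots> \<le> n_states * ?p" using ws(4) by simp
    also have "\<dots> = (n_states - 1) * ?p + ?p"
      using n_states_pos by (metis Suc_pred' add.commute mult_Suc)
    also have "\<dots> \<le> count (M + replicate_mset ?p a) a" using large by simp
    finally show False by (simp add: ws(1))
  qed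
  then obtain w us vs where w: "?p \<le> count (mset w) a" "ws = us @ w # vs"
    by (meson split_list)
  \<comment> \<open>Commutativity lets \<open>w\<close> be rearranged so that the \<open>?p\<close>
    copies of \<open>a\<close> stand in front, where \<open>lang_append_period\<close> removes
    them.\<close>
  obtain v where v: "mset v = mset w - replicate_mset ?p a" using ex_mset by blast
  have mw: "mset w = mset (replicate ?p a @ v)"
    using v w(1) by (simp add: count_le_replicate_mset_subset_eq)
  then have "v \<in> lang A"
    using lang_mset[OF mw] lang_append_period[OF a] ws(3) w(2) by simp
  moreover have "M = mset (concat (us @ v # vs))"
  proof -
    have "M + replicate_mset ?p a = mset (concat (us @ v # vs)) + replicate_mset ?p a"
      using ws(1) w(2) mw by simp
    then show ?thesis by (simp only: add_right_cancel)
  qed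
  ultimately show "M \<in> shuffle_sums (lang A)"
    using ws(3) w(2) unfolding shuffle_sums_def
    by (intro CollectI exI[of _ "us @ v # vs"]) auto
qed


section \<open>The counting automaton\<close>

text \<open>The sum is restricted to the alphabet because members of \<open>counters\<close> are
  \<open>undefined\<close> elsewhere.\<close>

definition mset_of :: "('a \<Rightarrow> nat) \<Rightarrow> 'a multiset" where
  "mset_of f = (\<Sum>a\<in>alphabet A. replicate_mset (f a) a)"

lemma count_mset_of: "count (mset_of f) a = (if a \<in> alphabet A then f a else 0)"
  using finite_alphabet by (simp add: mset_of_def count_sum sum.delta' if_distrib)

text \<open>On reaching \<open>n_states\<close> periods the counter drops by exactly one period, so
  it takes only values below that bound.\<close>

definition step :: "('a \<Rightarrow> nat) \<Rightarrow> 'a \<Rightarrow> 'a \<Rightarrow> nat" where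
  "step f a = f(a := if Suc (f a) < n_states * letter_period A a then Suc (f a)
                     else (n_states - 1) * letter_period A a)"

definition counters :: "('a \<Rightarrow> nat) set" where
  "counters = (\<Pi>\<^sub>E a\<in>alphabet A. {..<n_states * letter_period A a})"

text \<open>\<open>None\<close> stands for the empty word alone and is always accepting. It cannot
  be merged with the zero counters, whose acceptance depends on \<open>{#}\<close> and to which a
  non-empty word may return when \<open>n_states = 1\<close>.\<close>

definition counting_automaton :: "('a, ('a \<Rightarrow> nat) option) dfa" where
  "counting_automaton = \<lparr>
     alphabet = alphabet A,
     states = insert None (Some ` counters),
     trans = (\<lambda>q a. Some (step (case q of None \<Rightarrow> (\<lambda>b\<in>alphabet A. 0) | Some f \<Rightarrow> f) a)),
     init = None,
     final = insert None (Some ` {f \<in> counters. mset_of f \<in> shuffle_sums (lang A)})\<rparr>"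

lemma zero_in_counters: "(\<lambda>b\<in>alphabet A. 0) \<in> counters"
  using n_states_pos letter_period(1) by (auto simp: counters_def)

lemma step_in_counters:
  assumes "f \<in> counters" "a \<in> alphabet A"
  shows "step f a \<in> counters"
proof -
  have "(n_states - 1) * letter_period A a < n_states * letter_period A a"
    using n_states_pos letter_period(1)[OF assms(2)] by simp
  then show ?thesis
    using assms by (auto simp: counters_def step_def PiE_iff extensional_def)
qed

lemma finite_counters: "finite counters"
  using finite_alphabet by (auto simp: counters_def intro: finite_PiE)

lemma card_counters:
  "card counters = n_states ^ card (alphabet A) * (\<Prod>a\<in>alphabet A. letter_period A a)"
  using finite_alphabet by (simp add: counters_def card_PiE prod.distrib)

lemma automaton_counting_automaton: "automaton counting_automaton"
  using finite_alphabet finite_counters zero_in_counters step_in_counters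
  by unfold_locales (auto simp: counting_automaton_def)

text \<open>On overflow the two multisets differ by one period of \<open>a\<close>. The fallback
  value is precisely the threshold of \<open>shuffle_sums_period\<close>, and adding
  \<open>X\<close> can only increase the count.\<close>

lemma mset_of_step:
  assumes f: "f \<in> counters" and a: "a \<in> alphabet A"
  shows "mset_of (step f a) + X \<in> shuffle_sums (lang A) \<longleftrightarrow>
    add_mset a (mset_of f) + X \<in> shuffle_sums (lang A)"
proof (cases "Suc (f a) < n_states * letter_period A a")
  case True
  then have "mset_of (step f a) = add_mset a (mset_of f)"
    using a by (intro multiset_eqI) (auto simp: count_mset_of step_def)
  then show ?thesis by simp
next
  case False
  let ?p = "letter_period A a"
  have "f a < n_states * ?p" using f a by (auto simp: counters_def)
  with False have "Suc (f a) = n_states * ?p" by simp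
  also have "\<dots> = (n_states - 1) * ?p + ?p"
    using n_states_pos by (metis Suc_pred' add.commute mult_Suc)
  finally have "add_mset a (mset_of f) = mset_of (step f a) + replicate_mset ?p a"
    using a False by (intro multiset_eqI) (auto simp: count_mset_of step_def)
  then have "add_mset a (mset_of f) + X = mset_of (step f a) + X + replicate_mset ?p a"
    by (simp add: ac_simps)
  moreover have "(n_states - 1) * ?p \<le> count (mset_of (step f a) + X) a"
    using a False by (simp add: count_mset_of step_def)
  ultimately show ?thesis using shuffle_sums_period[OF a] by metis
qed

text \<open>
  The invariant is quantified over \<open>X\<close>, the letters still to be read, so that it says that the
  counters are Nerode equivalent to the word read so far.
\<close>

lemma run_counting_automaton:
  assumes "w \<in> lists (alphabet A)" "w \<noteq> []"
  shows "\<exists>f\<in>counters. run counting_automaton None w = Some f \<and>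
    (\<forall>X. mset_of f + X \<in> shuffle_sums (lang A) \<longleftrightarrow> mset w + X \<in> shuffle_sums (lang A))"
  using assms
proof (induction w rule: rev_induct)
  case Nil
  then show ?case by simp
next
  case (snoc a w)
  then have a: "a \<in> alphabet A" by simp
  have "\<exists>f\<in>counters. run counting_automaton None (w @ [a]) = Some (step f a) \<and>
    (\<forall>X. mset_of f + X \<in> shuffle_sums (lang A) \<longleftrightarrow> mset w + X \<in> shuffle_sums (lang A))"
  proof (cases "w = []")
    \<comment> \<open>\<open>None\<close> carries no counters, so the first letter is counted from
      the zero vector.\<close>
    case True
    have "mset_of (\<lambda>b\<in>alphabet A. 0) = {#}"
      by (intro multiset_eqI) (simp add: count_mset_of)
    then show ?thesis
      using True zero_in_counters
      by (intro bexI[of _ "\<lambda>b\<in>alphabet A. 0"]) (simp_all add: run_def counting_automaton_def)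
  next
    case False
    with snoc obtain f where "f \<in> counters" "run counting_automaton None w = Some f"
      "\<forall>X. mset_of f + X \<in> shuffle_sums (lang A) \<longleftrightarrow> mset w + X \<in> shuffle_sums (lang A)"
      by auto
    then show ?thesis
      by (intro bexI[of _ f]) (simp_all add: run_def counting_automaton_def)
  qed
  then obtain f where f: "f \<in> counters" "run counting_automaton None (w @ [a]) = Some (step f a)"
    "\<And>X. mset_of f + X \<in> shuffle_sums (lang A) \<longleftrightarrow> mset w + X \<in> shuffle_sums (lang A)"
    by blast
  \<comment> \<open>The invariant for \<open>w\<close> is used with \<open>a\<close> still among the
    letters to be read.\<close>
  have "mset_of (step f a) + X \<in> shuffle_sums (lang A) \<longleftrightarrow>
      mset (w @ [a]) + X \<in> shuffle_sums (lang A)" for X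
    using mset_of_step[OF f(1) a, of X] f(3)[of "add_mset a X"] by simp
  then show ?case using f step_in_counters[OF f(1) a] by blast
qed

lemma lang_counting_automaton: "lang counting_automaton = iterated_shuffle (lang A)"
proof -
  have "run counting_automaton None w \<in> final counting_automaton \<longleftrightarrow> w \<in> iterated_shuffle (lang A)"
    if w: "w \<in> lists (alphabet A)" for w
  proof (cases "w = []")
    case True
    then show ?thesis
      by (simp add: iterated_shuffle_iff[OF commutative] run_def counting_automaton_def)
  next
    case False
    obtain f where f: "f \<in> counters" "run counting_automaton None w = Some f"
      "\<And>X. mset_of f + X \<in> shuffle_sums (lang A) \<longleftrightarrow> mset w + X \<in> shuffle_sums (lang A)"
      using run_counting_automaton[OF w False] by blast
    have "Some f \<in> final counting_automaton \<longleftrightarrow> mset w \<in> shuffle_sums (lang A)"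
      using f(1) f(3)[of "{#}"] by (auto simp: counting_automaton_def)
    then show ?thesis using False f(2) by (simp add: iterated_shuffle_iff[OF commutative])
  qed
  moreover have "alphabet counting_automaton = alphabet A" "init counting_automaton = None"
    by (simp_all add: counting_automaton_def)
  ultimately show ?thesis
    using iterated_shuffle_subset_lists[OF commutative] by (auto simp: lang_def)
qed

end

theorem proposition12:
  fixes \<Sigma> :: "'a set" and L :: "'a list set" and A :: "('a, 'q) dfa"
  assumes "finite \<Sigma>"
    and "L \<subseteq> lists \<Sigma>"
    and "commutative_language \<Sigma> L"
    and "group_language \<Sigma> L"
    and "permutation_automaton A"
    and "minimal_automaton A"
    and "alphabet A = \<Sigma>"
    and "lang A = L"
  shows "regular \<Sigma> (iterated_shuffle L) \<and>
    (\<exists>B :: ('a, nat) dfa. automaton B \<and> alphabet B = \<Sigma> \<and> lang B = iterated_shuffle L \<and>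
       card (states B) \<le> card (states A) ^ card \<Sigma> * (\<Prod>a\<in>\<Sigma>. letter_period A a) + 1)"
proof -
  interpret commutative_permutation_automaton A
    using assms by (simp add: commutative_permutation_automaton_def
        commutative_permutation_automaton_axioms_def)
  \<comment> \<open>The states are renamed to natural numbers, over which \<open>regular\<close>
    quantifies.\<close>
  obtain B :: "('a, nat) dfa" where B: "automaton B" "alphabet B = alphabet counting_automaton"
      "lang B = lang counting_automaton" "card (states B) = card (states counting_automaton)"
    using ex_nat_automaton[OF automaton_counting_automaton] by blast
  have "card (states counting_automaton) = card counters + 1"
    using finite_counters by (simp add: counting_automaton_def card_image)
  then have "card (states B) \<le> card (states A) ^ card \<Sigma> * (\<Prod>a\<in>\<Sigma>. letter_period A a) + 1"
    using B(4) card_counters assms(7) by simp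
  moreover have "alphabet B = \<Sigma>" "lang B = iterated_shuffle L"
    using B lang_counting_automaton assms(7,8) by (simp_all add: counting_automaton_def)
  ultimately show ?thesis using B(1) unfolding regular_def by blast
qed

end
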